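(* Let $I\subset\mathbb{R}$ be an open interval, let $r:I\to\mathbb{R}$ be a smooth function, and let $M\subset\mathbb{E}^4$ be the Aminov surface given by the patch $X(u,v)=(u,v,r(u)\cos v,r(u)\sin v)$. Let $K$ and $K_N$ denote the Gaussian curvature and the Gaussian torsion of $M$. If $K+K_N=0$ on $M$, then $$\bigl(r(u)-r'(u)\bigr)\Bigl(r'(u)\bigl(1+(r'(u))^2\bigr)-r''(u)\bigl(1+r(u)^2\bigr)\Bigr)=0 .$$
   Context: For a Monge patch $X(u,v)=(u,v,f(u,v),g(u,v))$ in Euclidean 4-space $\mathbb{E}^4$ (here $f=r(u)\cos v$, $g=r(u)\sin v$) put $E=\langle X_u,X_u\rangle$, $F=\langle X_u,X_v\rangle$, $G=\langle X_v,X_v\rangle$, $W=\sqrt{EG-F^2}$, $A=1+f_u^2+f_v^2$, $B=f_ug_u+f_vg_v$, and use the orthonormal normal frame $$N_1=\tfrac{1}{\sqrt A}(-f_u,-f_v,1,0),\qquad N_2=\tfrac{1}{W\sqrt A}(Bf_u-Ag_u,\;Bf_v-Ag_v,\;-B,\;A).$$ For $k=1,2$ let $c_{11}^k=\langle X_{uu},N_k\rangle$, $c_{12}^k=\langle X_{uv},N_k\rangle$, $c_{22}^k=\langle X_{vv},N_k\rangle$. The Gaussian curvature is $K=\frac{1}{W^2}\sum_{k=1}^2\bigl(c_{11}^kc_{22}^k-(c_{12}^k)^2\bigr)$, and the Gaussian torsion is $$K_N=\frac{1}{W^3}\Bigl(E(c_{12}^1c_{22}^2-c_{12}^2c_{22}^1)-F(c_{11}^1c_{22}^2-c_{11}^2c_{22}^1)+G(c_{11}^1c_{12}^2-c_{11}^2c_{12}^1)\Bigr).$$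 *)

theory Defs
  imports "HOL-Analysis.Analysis"
begin

definition smooth_real_on :: "real set \<Rightarrow> (real \<Rightarrow> real) \<Rightarrow> bool" where
  "smooth_real_on S r \<longleftrightarrow> (\<forall>n. \<forall>x\<in>S. (deriv ^^ n) r differentiable (at x))"

text \<open>Functions of the two parameters \<open>u, v\<close> are curried. The partial derivatives apply both to
  the real coordinate functions and to the patch itself.\<close>

definition partial_u :: "(real \<Rightarrow> real \<Rightarrow> 'a::real_normed_vector) \<Rightarrow> real \<Rightarrow> real \<Rightarrow> 'a" where
  "partial_u h u v = vector_derivative (\<lambda>t. h t v) (at u)"

definition partial_v :: "(real \<Rightarrow> real \<Rightarrow> 'a::real_normed_vector) \<Rightarrow> real \<Rightarrow> real \<Rightarrow> 'a" where
  "partial_v h u v = vector_derivative (\<lambda>t. h u t) (at v)"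

definition monge_patch :: "(real \<Rightarrow> real \<Rightarrow> real) \<Rightarrow> (real \<Rightarrow> real \<Rightarrow> real) \<Rightarrow> real \<Rightarrow> real \<Rightarrow> real^4" where
  "monge_patch f g u v = vector [u, v, f u v, g u v]"

definition monge_E :: "(real \<Rightarrow> real \<Rightarrow> real) \<Rightarrow> (real \<Rightarrow> real \<Rightarrow> real) \<Rightarrow> real \<Rightarrow> real \<Rightarrow> real" where
  "monge_E f g u v = partial_u (monge_patch f g) u v \<bullet> partial_u (monge_patch f g) u v"

definition monge_F :: "(real \<Rightarrow> real \<Rightarrow> real) \<Rightarrow> (real \<Rightarrow> real \<Rightarrow> real) \<Rightarrow> real \<Rightarrow> real \<Rightarrow> real" where
  "monge_F f g u v = partial_u (monge_patch f g) u v \<bullet> partial_v (monge_patch f g) u v"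

definition monge_G :: "(real \<Rightarrow> real \<Rightarrow> real) \<Rightarrow> (real \<Rightarrow> real \<Rightarrow> real) \<Rightarrow> real \<Rightarrow> real \<Rightarrow> real" where
  "monge_G f g u v = partial_v (monge_patch f g) u v \<bullet> partial_v (monge_patch f g) u v"

definition monge_W :: "(real \<Rightarrow> real \<Rightarrow> real) \<Rightarrow> (real \<Rightarrow> real \<Rightarrow> real) \<Rightarrow> real \<Rightarrow> real \<Rightarrow> real" where
  "monge_W f g u v = sqrt (monge_E f g u v * monge_G f g u v - (monge_F f g u v)\<^sup>2)"

definition monge_A :: "(real \<Rightarrow> real \<Rightarrow> real) \<Rightarrow> real \<Rightarrow> real \<Rightarrow> real" where
  "monge_A f u v = 1 + (partial_u f u v)\<^sup>2 + (partial_v f u v)\<^sup>2"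

definition monge_B :: "(real \<Rightarrow> real \<Rightarrow> real) \<Rightarrow> (real \<Rightarrow> real \<Rightarrow> real) \<Rightarrow> real \<Rightarrow> real \<Rightarrow> real" where
  "monge_B f g u v = partial_u f u v * partial_u g u v + partial_v f u v * partial_v g u v"

definition monge_N1 :: "(real \<Rightarrow> real \<Rightarrow> real) \<Rightarrow> real \<Rightarrow> real \<Rightarrow> real^4" where
  "monge_N1 f u v =
    (1 / sqrt (monge_A f u v)) *\<^sub>R vector [- partial_u f u v, - partial_v f u v, 1, 0]"

definition monge_N2 :: "(real \<Rightarrow> real \<Rightarrow> real) \<Rightarrow> (real \<Rightarrow> real \<Rightarrow> real) \<Rightarrow> real \<Rightarrow> real \<Rightarrow> real^4" where
  "monge_N2 f g u v =
    (1 / (monge_W f g u v * sqrt (monge_A f u v))) *\<^sub>R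
      vector [monge_B f g u v * partial_u f u v - monge_A f u v * partial_u g u v,
              monge_B f g u v * partial_v f u v - monge_A f u v * partial_v g u v,
              - monge_B f g u v,
              monge_A f u v]"

definition monge_N :: "(real \<Rightarrow> real \<Rightarrow> real) \<Rightarrow> (real \<Rightarrow> real \<Rightarrow> real) \<Rightarrow> nat \<Rightarrow> real \<Rightarrow> real \<Rightarrow> real^4" where
  "monge_N f g k u v = (if k = 1 then monge_N1 f u v else monge_N2 f g u v)"

text \<open>Coefficients of the second fundamental form; the index \<open>k\<close> is only used for \<open>k = 1, 2\<close>.\<close>

definition monge_c11 :: "(real \<Rightarrow> real \<Rightarrow> real) \<Rightarrow> (real \<Rightarrow> real \<Rightarrow> real) \<Rightarrow> nat \<Rightarrow> real \<Rightarrow> real \<Rightarrow> real" where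
  "monge_c11 f g k u v = partial_u (partial_u (monge_patch f g)) u v \<bullet> monge_N f g k u v"

definition monge_c12 :: "(real \<Rightarrow> real \<Rightarrow> real) \<Rightarrow> (real \<Rightarrow> real \<Rightarrow> real) \<Rightarrow> nat \<Rightarrow> real \<Rightarrow> real \<Rightarrow> real" where
  "monge_c12 f g k u v = partial_v (partial_u (monge_patch f g)) u v \<bullet> monge_N f g k u v"

definition monge_c22 :: "(real \<Rightarrow> real \<Rightarrow> real) \<Rightarrow> (real \<Rightarrow> real \<Rightarrow> real) \<Rightarrow> nat \<Rightarrow> real \<Rightarrow> real \<Rightarrow> real" where
  "monge_c22 f g k u v = partial_v (partial_v (monge_patch f g)) u v \<bullet> monge_N f g k u v"

definition gaussian_curvature ::
    "(real \<Rightarrow> real \<Rightarrow> real) \<Rightarrow> (real \<Rightarrow> real \<Rightarrow> real) \<Rightarrow> real \<Rightarrow> real \<Rightarrow> real" where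
  "gaussian_curvature f g u v =
    1 / (monge_W f g u v)\<^sup>2 *
      (\<Sum>k\<in>{1, 2}. monge_c11 f g k u v * monge_c22 f g k u v - (monge_c12 f g k u v)\<^sup>2)"

definition gaussian_torsion ::
    "(real \<Rightarrow> real \<Rightarrow> real) \<Rightarrow> (real \<Rightarrow> real \<Rightarrow> real) \<Rightarrow> real \<Rightarrow> real \<Rightarrow> real" where
  "gaussian_torsion f g u v =
    1 / (monge_W f g u v) ^ 3 *
      (monge_E f g u v * (monge_c12 f g 1 u v * monge_c22 f g 2 u v
                          - monge_c12 f g 2 u v * monge_c22 f g 1 u v)
       - monge_F f g u v * (monge_c11 f g 1 u v * monge_c22 f g 2 u v
                            - monge_c11 f g 2 u v * monge_c22 f g 1 u v)
       + monge_G f g u v * (monge_c11 f g 1 u v * monge_c12 f g 2 u v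
                            - monge_c11 f g 2 u v * monge_c12 f g 1 u v))"

text \<open>The Aminov surface of \<open>r\<close> is the Monge patch of the following two functions.\<close>

definition aminov_f :: "(real \<Rightarrow> real) \<Rightarrow> real \<Rightarrow> real \<Rightarrow> real" where
  "aminov_f r u v = r u * cos v"

definition aminov_g :: "(real \<Rightarrow> real) \<Rightarrow> real \<Rightarrow> real \<Rightarrow> real" where
  "aminov_g r u v = r u * sin v"

end

theory Submission
  imports Defs
begin

text \<open>Rotation invariance makes \<open>K + K\<^sub>N\<close> independent of \<open>v\<close>, so nothing is lost by
  evaluating at \<open>v = 0\<close>. There the orthonormal frame splits the second fundamental form, the only nonzero
  coefficients being \<open>c\<^sub>1\<^sub>1\<^sup>1\<close>, \<open>c\<^sub>2\<^sub>2\<^sup>1\<close> and \<open>c\<^sub>1\<^sub>2\<^sup>2\<close>, and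
  \<open>W\<^sup>4 (K + K\<^sub>N)\<close> is exactly the claimed product.\<close>

lemma vector_4_nth [simp]:
  "(vector [a, b, c, d] :: 'a::zero^4) $ 1 = a"
  "(vector [a, b, c, d] :: 'a::zero^4) $ 2 = b"
  "(vector [a, b, c, d] :: 'a::zero^4) $ 3 = c"
  "(vector [a, b, c, d] :: 'a::zero^4) $ 4 = d"
  by (simp_all add: vector_def)

text \<open>Expanding in the standard basis turns the curve into a sum of scalar functions times
  constant vectors, so the sum and scaling rules apply.\<close>

lemma has_vector_derivative_vector_4:
  fixes a b c d :: "real \<Rightarrow> real"
  assumes "(a has_real_derivative a') (at t)" "(b has_real_derivative b') (at t)"
    and "(c has_real_derivative c') (at t)" "(d has_real_derivative d') (at t)"
  shows "((\<lambda>t. vector [a t, b t, c t, d t] :: real^4) has_vector_derivative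
           vector [a', b', c', d']) (at t)"
proof -
  have eq: "(vector [w, x, y, z] :: real^4) =
      w *\<^sub>R axis 1 1 + x *\<^sub>R axis 2 1 + y *\<^sub>R axis 3 1 + z *\<^sub>R axis 4 1" for w x y z
    by (simp add: vec_eq_iff forall_4 axis_def)
  show ?thesis
    unfolding eq
    by (intro has_vector_derivative_add
          has_vector_derivative_scaleR[OF _ has_vector_derivative_const, simplified] assms)
qed

lemmas vector_derivative_vector_4 =
  vector_derivative_at[OF has_vector_derivative_vector_4]

lemma inner_vector_4:
  "(vector [a, b, c, d] :: real^4) \<bullet> vector [a', b', c', d'] = a * a' + b * b' + c * c' + d * d'"
  by (simp add: inner_vec_def sum_4)

context
  fixes I :: "real set" and r :: "real \<Rightarrow> real"
  assumes I: "open I" and r: "smooth_real_on I r"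
begin

text \<open>These are the cases \<open>n = 0\<close> and \<open>n = 1\<close> of smoothness;
  curvature and torsion involve \<open>r\<close> only up to its second derivative.\<close>

lemma smooth_DERIV:
  assumes "u \<in> I"
  shows "(r has_real_derivative deriv r u) (at u)"
    and "(deriv r has_real_derivative deriv (deriv r) u) (at u)"
  using r assms unfolding smooth_real_on_def
  by (metis DERIV_deriv_iff_real_differentiable funpow_0,
      metis DERIV_deriv_iff_real_differentiable funpow_simps_right(1) funpow.simps(2) comp_apply id_apply)

lemma partial_aminov:
  assumes "u \<in> I"
  shows "partial_u (aminov_f r) u v = deriv r u * cos v"
    and "partial_u (aminov_g r) u v = deriv r u * sin v"
    and "partial_v (aminov_f r) u v = - r u * sin v"
    and "partial_v (aminov_g r) u v = r u * cos v"
  unfolding partial_u_def partial_v_def aminov_f_def aminov_g_def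
  by (rule vector_derivative_at,
      auto simp flip: has_real_derivative_iff_has_vector_derivative
           intro!: derivative_eq_intros smooth_DERIV[OF assms])+

abbreviation "X \<equiv> monge_patch (aminov_f r) (aminov_g r)"

lemma partial_patch:
  shows "u \<in> I \<Longrightarrow> partial_u X u v = vector [1, 0, deriv r u * cos v, deriv r u * sin v]"
    and "partial_v X u v = vector [0, 1, - r u * sin v, r u * cos v]"
  unfolding partial_u_def partial_v_def monge_patch_def aminov_f_def aminov_g_def
  by (rule vector_derivative_vector_4; auto intro!: derivative_eq_intros smooth_DERIV)+

lemma partial2_patch:
  assumes u: "u \<in> I"
  shows "partial_u (partial_u X) u v =
           vector [0, 0, deriv (deriv r) u * cos v, deriv (deriv r) u * sin v]" (is ?uu)
    and "partial_v (partial_u X) u v = vector [0, 0, - deriv r u * sin v, deriv r u * cos v]" (is ?uv)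
    and "partial_v (partial_v X) u v = vector [0, 0, - r u * cos v, - r u * sin v]" (is ?vv)
proof -
  have "((\<lambda>t. vector [1, 0, deriv r t * cos v, deriv r t * sin v] :: real^4) has_vector_derivative
      vector [0, 0, deriv (deriv r) u * cos v, deriv (deriv r) u * sin v]) (at u)"
    by (rule has_vector_derivative_vector_4; auto intro!: derivative_eq_intros smooth_DERIV u)
  \<comment> \<open>The closed form of \<open>partial_u X\<close> is available only over
    \<open>I\<close>. As \<open>I\<close> is an open neighbourhood of \<open>u\<close>, agreement
    there suffices for the derivative at \<open>u\<close>.\<close>
  then have "((\<lambda>t. partial_u X t v) has_vector_derivative
      vector [0, 0, deriv (deriv r) u * cos v, deriv (deriv r) u * sin v]) (at u)"
    by (rule has_vector_derivative_transform_within_open[OF _ I u]) (simp add: partial_patch)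
  then show ?uu
    unfolding partial_u_def[of "partial_u X"] by (rule vector_derivative_at)
  show ?uv
    unfolding partial_v_def partial_patch(1)[OF u]
    by (rule vector_derivative_vector_4; auto intro!: derivative_eq_intros)
  show ?vv
    unfolding partial_v_def[of "partial_v X"] partial_patch(2)
    by (rule vector_derivative_vector_4; auto intro!: derivative_eq_intros)
qed

lemma curvature_plus_torsion:
  assumes u: "u \<in> I"
  shows "(1 + (deriv r u)\<^sup>2)\<^sup>2 * (1 + (r u)\<^sup>2)\<^sup>2 *
           (gaussian_curvature (aminov_f r) (aminov_g r) u 0
            + gaussian_torsion (aminov_f r) (aminov_g r) u 0) =
         (r u - deriv r u) *
           (deriv r u * (1 + (deriv r u)\<^sup>2) - deriv (deriv r) u * (1 + (r u)\<^sup>2))"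
proof -
  let ?f = "aminov_f r" and ?g = "aminov_g r"
  define p q s where "p = r u" and "q = deriv r u" and "s = deriv (deriv r) u"
  \<comment> \<open>At \<open>v = 0\<close> the \<open>v\<close>-derivative of
    \<open>aminov_f r\<close> vanishes, so \<open>monge_A\<close> and \<open>monge_E\<close>
    coincide and one letter \<open>A\<close> serves for both.\<close>
  define A G a w where "A = 1 + q\<^sup>2" and "G = 1 + p\<^sup>2" and "a = sqrt A" and "w = sqrt (A * G)"
  have pos: "A > 0" "G > 0"
    by (simp_all add: A_def G_def add_pos_nonneg)
  then have aw: "a > 0" "w > 0" "a\<^sup>2 = A" "w\<^sup>2 = A * G"
    by (simp_all add: a_def w_def)
  have E: "monge_E ?f ?g u 0 = A" and F: "monge_F ?f ?g u 0 = 0" and G: "monge_G ?f ?g u 0 = G"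
    by (simp_all add: monge_E_def monge_F_def monge_G_def partial_patch u inner_vector_4
          A_def G_def p_def q_def power2_eq_square)
  have W: "monge_W ?f ?g u 0 = w"
    by (simp add: monge_W_def E F G w_def)
  have A: "monge_A ?f u 0 = A" and B: "monge_B ?f ?g u 0 = 0"
    by (simp_all add: monge_A_def monge_B_def partial_aminov u A_def q_def)
  note c = monge_c11_def monge_c12_def monge_c22_def monge_N_def monge_N1_def monge_N2_def
    partial2_patch partial_aminov u inner_vector_4 A B W
  \<comment> \<open>At \<open>v = 0\<close> the vectors X_uu and X_vv lie along the third axis and
    X_uv along the fourth. The first normal has no fourth component, and the second has no third one
    because B = 0.\<close>
  have c1: "monge_c11 ?f ?g 1 u 0 = s / a" "monge_c12 ?f ?g 1 u 0 = 0"
    "monge_c22 ?f ?g 1 u 0 = - p / a"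
    by (simp_all add: c a_def p_def s_def)
  have c2: "monge_c11 ?f ?g 2 u 0 = 0" "monge_c12 ?f ?g 2 u 0 = q * A / (w * a)"
    "monge_c22 ?f ?g 2 u 0 = 0"
    by (simp_all add: c a_def q_def)
  have K: "gaussian_curvature ?f ?g u 0 = - (s * p / a\<^sup>2 + (q * A)\<^sup>2 / (w\<^sup>2 * a\<^sup>2)) / w\<^sup>2"
    by (simp add: gaussian_curvature_def W c1[simplified] c2 power2_eq_square add_divide_distrib)
  \<comment> \<open>The factor 1/w in the only nonzero second-normal coefficient joins 1/w^3, so
    only even powers of the square roots \<open>w\<close> and \<open>a\<close> remain.\<close>
  have T: "gaussian_torsion ?f ?g u 0 = (q * A * (A * p + G * s)) / (w\<^sup>2 * w\<^sup>2 * a\<^sup>2)"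
    using aw(1,2)
    by (simp add: gaussian_torsion_def E F G W c1[simplified] c2 field_simps power2_eq_square power3_eq_cube)
  \<comment> \<open>Over the common denominator A^2 G^2 the numerators are -(spG + q^2 A) and q(Ap +
    Gs); their sum factors as stated.\<close>
  have "A\<^sup>2 * G\<^sup>2 * (gaussian_curvature ?f ?g u 0 + gaussian_torsion ?f ?g u 0)
      = (p - q) * (q * A - s * G)"
    unfolding K T aw(3,4) using pos by (simp add: field_simps power2_eq_square)
  then show ?thesis
    by (simp add: A_def G_def p_def q_def s_def)
qed

end

theorem proposition4p1:
  fixes I :: "real set" and r :: "real \<Rightarrow> real"
  assumes "open I" and "is_interval I"
    and "smooth_real_on I r"
    and "\<forall>u\<in>I. \<forall>v. gaussian_curvature (aminov_f r) (aminov_g r) u v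
                   + gaussian_torsion (aminov_f r) (aminov_g r) u v = 0"
  shows "\<forall>u\<in>I. (r u - deriv r u) *
           (deriv r u * (1 + (deriv r u)\<^sup>2) - deriv (deriv r) u * (1 + (r u)\<^sup>2)) = 0"
  using curvature_plus_torsion[OF assms(1,3)] assms(4) by (metis mult_zero_right)

end
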